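(* Let $p$ be a prime number, let $n \ge 1$, and let $m_i$ and $a_i$ be integers with $1 \leq m_i \leq p-1$ and $0 \leq a_i \leq p-1$ for each $i=1, 2, \ldots, n$. If $a_i \neq a_j$ whenever $i \neq j$, then we have the following congruence modulo $p$: $$\sum_{k=0}^{p-1} (a_1+k)^{m_1} \cdots (a_n+k)^{m_n} \equiv -\sum_{i \geq 1} [x^{i(p-1)-m_n}]\, (b_1+x)^{m_1} \cdots (b_{n-1}+x)^{m_{n-1}},$$ where $b_{i'}=a_{i'}-a_n$ for each $i'=1, 2, \ldots, n-1$.
   Context: $[x^j]f(x)$ denotes the coefficient of $x^j$ in the polynomial $f(x)$ (it is $0$ when $j > \deg f$, so the sum over integers $i \ge 1$ is finite). For $n=1$ the product $(b_1+x)^{m_1} \cdots (b_{n-1}+x)^{m_{n-1}}$ is the empty product $1$. *)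

theory Defs
  imports
    "HOL-Analysis.Infinite_Sum"
    "HOL-Computational_Algebra.Polynomial"
    "HOL-Computational_Algebra.Primes"
    "HOL-Number_Theory.Cong"
begin

text \<open>
  A sum over all \<open>i \<ge> 1\<close> of integer polynomial coefficients has only finitely many nonzero
  terms; written as an unconditional sum (\<open>int\<close> carries the discrete topology) it is
  summable and reduces to a finite sum.
\<close>

lemma
  fixes f :: "int poly"
  assumes "d > 0"
  shows summable_on_coeff: "(\<lambda>i. coeff f (i * d - m)) summable_on {1..}"
    and infsum_coeff:
      "(\<Sum>\<^sub>\<infinity>i\<in>{1..}. coeff f (i * d - m)) =
       (\<Sum>i | 1 \<le> i \<and> i * d \<le> degree f + m. coeff f (i * d - m))"
proof -
  let ?S = "{i. 1 \<le> i \<and> i * d \<le> degree f + m}"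
  have "i \<le> degree f + m" if "i * d \<le> degree f + m" for i
    using assms that by (metis dual_order.trans mult.right_neutral mult_le_mono2 Suc_leI One_nat_def)
  then have fin: "finite ?S"
    by (intro finite_subset[of ?S "{..degree f + m}"]) auto
  have zero: "coeff f (i * d - m) = 0" if "i \<in> {1..} - ?S" for i
    using that by (intro coeff_eq_0) auto
  have "(\<lambda>i. coeff f (i * d - m)) summable_on ?S"
    using fin by (rule summable_on_finite)
  also have "?this \<longleftrightarrow> (\<lambda>i. coeff f (i * d - m)) summable_on {1..}"
    using zero by (intro summable_on_cong_neutral) auto
  finally show "(\<lambda>i. coeff f (i * d - m)) summable_on {1..}" .
  have "(\<Sum>\<^sub>\<infinity>i\<in>{1..}. coeff f (i * d - m)) = (\<Sum>\<^sub>\<infinity>i\<in>?S. coeff f (i * d - m))"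
    using zero by (intro infsum_cong_neutral) auto
  also have "\<dots> = (\<Sum>i\<in>?S. coeff f (i * d - m))"
    using fin by (rule infsum_finite)
  finally show "(\<Sum>\<^sub>\<infinity>i\<in>{1..}. coeff f (i * d - m)) = (\<Sum>i\<in>?S. coeff f (i * d - m))" .
qed

end

theory Submission
  imports "HOL-Number_Theory.Residue_Primitive_Roots" Defs
begin

text \<open>
  Modulo \<open>p\<close>, the sum of an integer polynomial over all residues depends only on the power sums
  \<open>\<Sum>x. x ^ j\<close>, and these are \<open>-1\<close> if \<open>j\<close> is a positive multiple of \<open>p - 1\<close> and \<open>0\<close> otherwise
  (lemma \<open>power_sum_cong\<close>). Summing over the residues therefore gives minus the sum of the
  coefficients at the positive multiples of \<open>p - 1\<close> (lemma \<open>sum_poly_residues_cong\<close>).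

  In the theorem, \<open>x = a n + k\<close> runs through all residues as \<open>k\<close> does
  (lemma \<open>sum_residues_reindex_cong\<close>), and in terms of \<open>x\<close> the summand is \<open>x ^ m n * f x\<close> with
  \<open>f x = (b 1 + x) ^ m 1 * \<dots> * (b (n - 1) + x) ^ m (n - 1)\<close>. The factor \<open>x ^ m n\<close> moves every
  coefficient of \<open>f\<close> up by \<open>m n\<close> places, so the coefficients picked out are those of \<open>f\<close> at
  \<open>i * (p - 1) - m n\<close>. As \<open>m n \<le> p - 1\<close>, this subtraction of natural numbers is never truncated.
\<close>

text \<open>
  Up to congruence, \<open>F\<close> sees only the residues of its arguments, and \<open>\<sigma>\<close> induces an injective,
  hence bijective, self-map of the finite set of residues.
\<close>

lemma sum_residues_reindex_cong:
  fixes F \<sigma> :: "int \<Rightarrow> int"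
  assumes p: "p > 0"
    and F: "\<And>x y. [x = y] (mod p) \<Longrightarrow> [F x = F y] (mod p)"
    and \<sigma>: "\<And>x y. [\<sigma> x = \<sigma> y] (mod p) \<Longrightarrow> [x = y] (mod p)"
  shows "[(\<Sum>x\<in>{0..<p}. F (\<sigma> x)) = (\<Sum>x\<in>{0..<p}. F x)] (mod p)"
proof -
  let ?r = "\<lambda>x. \<sigma> x mod p"
  have inj: "inj_on ?r {0..<p}"
  proof (rule inj_onI)
    fix x y assume xy: "x \<in> {0..<p}" "y \<in> {0..<p}" "?r x = ?r y"
    then have "[\<sigma> x = \<sigma> y] (mod p)"
      by (simp add: cong_def)
    then have "[x = y] (mod p)"
      by (rule \<sigma>)
    with xy show "x = y"
      by (simp add: cong_def)
  qed
  have "?r ` {0..<p} = {0..<p}"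
    using p inj by (intro endo_inj_surj) auto
  with inj have "bij_betw ?r {0..<p} {0..<p}"
    by (simp add: bij_betw_def)
  then have "(\<Sum>x\<in>{0..<p}. F (?r x)) = (\<Sum>x\<in>{0..<p}. F x)"
    by (rule sum.reindex_bij_betw)
  moreover have "[(\<Sum>x\<in>{0..<p}. F (\<sigma> x)) = (\<Sum>x\<in>{0..<p}. F (?r x))] (mod p)"
    by (intro cong_sum F) (simp add: cong_def)
  ultimately show ?thesis
    by simp
qed

text \<open>
  If \<open>p - 1\<close> does not divide \<open>j\<close>, multiplying the residues by a primitive root \<open>g\<close> permutes them
  but multiplies the power sum by \<open>g ^ j\<close>, which is not congruent to \<open>1\<close>; so the sum vanishes.
  If \<open>p - 1\<close> divides \<open>j > 0\<close>, Fermat's theorem makes each of the \<open>p - 1\<close> nonzero residues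
  contribute \<open>1\<close>. The exponent \<open>0\<close> is different because \<open>0 ^ 0 = 1\<close>, which gives the sum \<open>p\<close>.
\<close>

lemma power_sum_cong:
  fixes p j :: nat
  assumes p: "prime p"
  shows "[(\<Sum>x\<in>{0..<int p}. x ^ j) = (if 0 < j \<and> (p - 1) dvd j then -1 else 0)] (mod int p)"
proof -
  have p1: "p > 1"
    using p by (rule prime_gt_1_nat)
  have pint: "prime (int p)"
    using p by simp
  consider "j = 0" | "j > 0" "(p - 1) dvd j" | "\<not> (p - 1) dvd j"
    by blast
  then show ?thesis
  proof cases
    case 1
    then show ?thesis
      by (simp add: cong_0_iff)
  next
    case 2
    have fermat: "[x ^ j = 1] (mod int p)" if x: "x \<in> {1..<int p}" for x :: int
    proof -
      have "\<not> p dvd nat x"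
        using x by (auto dest: dvd_imp_le)
      then have "[nat x ^ (p - 1) = 1] (mod p)"
        by (intro fermat_theorem p)
      then have "[int (nat x ^ (p - 1)) = int 1] (mod int p)"
        by (simp only: cong_int_iff)
      then have "[x ^ (p - 1) = 1] (mod int p)"
        using x by simp
      then have "[(x ^ (p - 1)) ^ (j div (p - 1)) = 1 ^ (j div (p - 1))] (mod int p)"
        by (rule cong_pow)
      moreover have "(p - 1) * (j div (p - 1)) = j"
        using 2 by simp
      ultimately show ?thesis
        by (simp only: power_mult[symmetric] power_one)
    qed
    have "{0..<int p} = insert 0 {1..<int p}"
      using p1 by auto
    then have "(\<Sum>x\<in>{0..<int p}. x ^ j) = (\<Sum>x\<in>{1..<int p}. x ^ j)"
      using 2 by simp
    also have "[\<dots> = (\<Sum>x\<in>{1..<int p}. 1)] (mod int p)"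
      by (intro cong_sum fermat)
    also have "[(\<Sum>x\<in>{1..<int p}. 1) = -1] (mod int p)"
      using p1 by (simp add: cong_iff_dvd_diff of_nat_diff)
    finally show ?thesis
      using 2 by simp
  next
    case 3
    obtain g where g: "residue_primroot p g"
      using prime_primitive_root_exists[of p] p p1 by auto
    then have cop: "coprime (int g) (int p)"
      by (simp add: residue_primroot_def coprime_commute)
    have "\<not> [g ^ j = 1] (mod p)"
      using g 3 p by (simp add: ord_divides' residue_primroot_def totient_prime)
    then have "\<not> [int (g ^ j) = int 1] (mod int p)"
      by (simp only: cong_int_iff not_False_eq_True)
    then have ne: "\<not> int p dvd int g ^ j - 1"
      by (simp add: cong_iff_dvd_diff)
    let ?S = "\<Sum>x\<in>{0..<int p}. x ^ j"
    have "[(\<Sum>x\<in>{0..<int p}. (int g * x) ^ j) = ?S] (mod int p)"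
      by (rule sum_residues_reindex_cong[where F = "\<lambda>x. x ^ j" and \<sigma> = "\<lambda>x. int g * x"])
        (use p1 cop in \<open>auto simp: cong_mult_lcancel intro: cong_pow\<close>)
    then have "[int g ^ j * ?S = ?S] (mod int p)"
      by (simp add: power_mult_distrib sum_distrib_left)
    then have "int p dvd (int g ^ j - 1) * ?S"
      by (simp add: cong_iff_dvd_diff left_diff_distrib)
    then have "int p dvd ?S"
      using ne pint by (simp add: prime_dvd_mult_iff)
    then show ?thesis
      using 3 by (auto simp: cong_0_iff)
  qed
qed

text \<open>
  Exchanging the two summations leaves each coefficient multiplied by a power sum. The constant
  term is not picked up although \<open>p - 1\<close> divides \<open>0\<close>, because the power sum of exponent \<open>0\<close> is
  \<open>p\<close>; hence the index \<open>i\<close> starts at \<open>1\<close>.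
\<close>

lemma sum_poly_residues_cong:
  fixes p :: nat and F :: "int poly"
  assumes p: "prime p"
  shows "[(\<Sum>x\<in>{0..<int p}. poly F x) = - (\<Sum>\<^sub>\<infinity>i\<in>{1..}. coeff F (i * (p - 1)))] (mod int p)"
proof -
  let ?d = "p - 1"
  let ?J = "{j \<in> {..degree F}. 0 < j \<and> ?d dvd j}"
  let ?I = "{i. 1 \<le> i \<and> i * ?d \<le> degree F}"
  have d: "?d > 0"
    using prime_gt_1_nat[OF p] by simp
  have "(\<Sum>x\<in>{0..<int p}. poly F x) = (\<Sum>j\<le>degree F. coeff F j * (\<Sum>x\<in>{0..<int p}. x ^ j))"
    unfolding poly_altdef sum_distrib_left by (rule sum.swap)
  also have "[\<dots> = (\<Sum>j\<le>degree F. coeff F j * (if 0 < j \<and> ?d dvd j then -1 else 0))] (mod int p)"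
    by (intro cong_sum cong_mult cong_refl power_sum_cong p)
  also have "(\<Sum>j\<le>degree F. coeff F j * (if 0 < j \<and> ?d dvd j then -1 else 0)) =
      (\<Sum>j\<le>degree F. if 0 < j \<and> ?d dvd j then - coeff F j else 0)"
    by (intro sum.cong) auto
  also have "\<dots> = - (\<Sum>j\<in>?J. coeff F j)"
    unfolding sum_negf[symmetric] by (rule sum.inter_filter[symmetric]) simp
  also have "(\<Sum>j\<in>?J. coeff F j) = (\<Sum>i\<in>?I. coeff F (i * ?d))"
  proof (rule sum.reindex_bij_betw[symmetric])
    show "bij_betw (\<lambda>i. i * ?d) ?I ?J"
    proof (rule bij_betw_imageI)
      show "inj_on (\<lambda>i. i * ?d) ?I"
        using d by (intro inj_onI) simp
      show "(\<lambda>i. i * ?d) ` ?I = ?J"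
      proof (intro equalityI subsetI)
        fix j assume j: "j \<in> ?J"
        then have "j = (j div ?d) * ?d"
          by simp
        moreover from this j have "j div ?d \<in> ?I"
          by (cases "j div ?d = 0") auto
        ultimately show "j \<in> (\<lambda>i. i * ?d) ` ?I"
          by (rule image_eqI)
      qed (use d in auto)
    qed
  qed
  also have "\<dots> = (\<Sum>\<^sub>\<infinity>i\<in>{1..}. coeff F (i * ?d))"
    using infsum_coeff[OF d, of F 0] by simp
  finally show ?thesis .
qed

theorem theorem4p4:
  fixes p n :: nat and m :: "nat \<Rightarrow> nat" and a b :: "nat \<Rightarrow> int"
  assumes "prime p"
    and "n \<ge> 1"
    and "\<And>i. i \<in> {1..n} \<Longrightarrow> 1 \<le> m i \<and> m i \<le> p - 1"
    and "\<And>i. i \<in> {1..n} \<Longrightarrow> 0 \<le> a i \<and> a i \<le> int p - 1"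
    and "\<And>i j. i \<in> {1..n} \<Longrightarrow> j \<in> {1..n} \<Longrightarrow> i \<noteq> j \<Longrightarrow> a i \<noteq> a j"
    and "\<And>i. i \<in> {1..n - 1} \<Longrightarrow> b i = a i - a n"
  shows "[(\<Sum>k = 0..p - 1. \<Prod>i = 1..n. (a i + int k) ^ m i) =
          - (\<Sum>\<^sub>\<infinity>i\<in>{1..}. coeff (\<Prod>j = 1..n - 1. [:b j, 1:] ^ m j) (i * (p - 1) - m n))]
         (mod int p)"
proof -
  let ?f = "\<Prod>j = 1..n - 1. [:b j, 1:] ^ m j"
  define F where "F = monom 1 (m n) * ?f"
  have p1: "p > 1"
    using assms(1) by (rule prime_gt_1_nat)
  have split: "{1..n} = insert n {1..n - 1}" "n \<notin> {1..n - 1}"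
    using assms(2) by auto
  have summand: "(\<Prod>i = 1..n. (a i + x) ^ m i) = poly F (a n + x)" for x
  proof -
    have "(\<Prod>i = 1..n - 1. (a i + x) ^ m i) = poly ?f (a n + x)"
      unfolding poly_prod by (intro prod.cong) (auto simp: assms(6))
    then show ?thesis
      unfolding split(1) using split(2) by (simp add: F_def poly_monom)
  qed
  have "{0..<int p} = int ` {0..p - 1}"
    using p1 by (auto simp: image_int_atLeastAtMost)
  then have "(\<Sum>k = 0..p - 1. \<Prod>i = 1..n. (a i + int k) ^ m i) =
      (\<Sum>x\<in>{0..<int p}. poly F (a n + x))"
    unfolding summand by (simp add: sum.reindex)
  also have "[\<dots> = (\<Sum>x\<in>{0..<int p}. poly F x)] (mod int p)"
  proof (rule sum_residues_reindex_cong[where F = "poly F" and \<sigma> = "\<lambda>x. a n + x"])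
    show "[poly F x = poly F y] (mod int p)" if "[x = y] (mod int p)" for x y
      unfolding poly_altdef by (intro cong_sum cong_mult cong_pow cong_refl that)
  qed (use p1 in \<open>simp_all add: cong_add_lcancel\<close>)
  also have "[(\<Sum>x\<in>{0..<int p}. poly F x) =
      - (\<Sum>\<^sub>\<infinity>i\<in>{1..}. coeff F (i * (p - 1)))] (mod int p)"
    by (rule sum_poly_residues_cong) (rule assms(1))
  also have "(\<Sum>\<^sub>\<infinity>i\<in>{1..}. coeff F (i * (p - 1))) =
      (\<Sum>\<^sub>\<infinity>i\<in>{1..}. coeff ?f (i * (p - 1) - m n))"
  proof (rule infsum_cong)
    fix i :: nat assume "i \<in> {1..}"
    moreover have "m n \<le> p - 1"
      using assms(2,3) by simp
    ultimately have "m n \<le> i * (p - 1)"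
      by (metis atLeast_iff mult_le_mono1 nat_mult_1 order_trans)
    then show "coeff F (i * (p - 1)) = coeff ?f (i * (p - 1) - m n)"
      by (simp add: F_def coeff_monom_mult)
  qed
  finally show ?thesis .
qed

end
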